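(* Let $W$ be a Coxeter group of type $E_8$ with Vogan representation $\phi$. Then $\mathrm{Ker}\,\phi$ has order $2$. Moreover, $\mathrm{Ker}\,\phi=Z(W)$, the center of $W$.
   Context: The Coxeter graph of type $E_8$ has vertex set $S=\{s_1,\dots,s_8\}$ and edge set $R=\{s_is_{i+1}: 1\le i\le 6\}\cup\{s_5s_8\}$. The Coxeter group $W$ of type $E_8$ is generated by $S$ with relations $s^2=1$, $(ss')^3=1$ if $ss'\in R$, and $(ss')^2=1$ if $s\ne s'$, $ss'\notin R$. $F_2^8$ is the space of column vectors over the two-element field $F_2$ indexed by $S$, and $\widetilde{s}$ is the characteristic vector of $s\in S$. For $s\in S$, $\mathbf{s}$ is the $8\times 8$ matrix over $F_2$ acting by $\mathbf{s}\widetilde{v}=\widetilde{v}$ for $v\ne s$ and $\mathbf{s}\widetilde{s}=\widetilde{s}+\sum_{us\in R}\widetilde{u}$. The Vogan representation of $W$ is the homomorphism $\phi:W\to\mathrm{GL}_8(F_2)$ with $\phi(s)=\mathbf{s}$ for $s\in S$. *)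

theory Defs
  imports "HOL-Algebra.Coset" "HOL-Analysis.Cartesian_Space" "HOL-Library.Z2"
begin

section \<open>Groups given by generators and relations\<close>

text \<open>A letter \<open>(x, True)\<close> stands for the generator \<open>x\<close>, and \<open>(x, False)\<close> for its formal inverse.
  A word in \<open>R\<close> is a relator, i.e. it is set equal to the identity.\<close>

type_synonym 'a word = "('a \<times> bool) list"

inductive word_equiv :: "'a word set \<Rightarrow> 'a word \<Rightarrow> 'a word \<Rightarrow> bool" for R where
  refl: "word_equiv R u u"
| sym: "word_equiv R u v \<Longrightarrow> word_equiv R v u"
| trans: "word_equiv R u v \<Longrightarrow> word_equiv R v w \<Longrightarrow> word_equiv R u w"
| append: "word_equiv R u u' \<Longrightarrow> word_equiv R v v' \<Longrightarrow> word_equiv R (u @ v) (u' @ v')"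
| cancel: "word_equiv R [(x, b), (x, \<not> b)] []"
| relator: "r \<in> R \<Longrightarrow> word_equiv R r []"

definition word_class :: "'a word set \<Rightarrow> 'a word \<Rightarrow> 'a word set" where
  "word_class R w = {v. word_equiv R w v}"

definition presented_group :: "'a word set \<Rightarrow> 'a word set monoid" where
  "presented_group R =
    \<lparr>carrier = range (word_class R),
     mult = (\<lambda>X Y. \<Union>u\<in>X. \<Union>v\<in>Y. word_class R (u @ v)),
     one = word_class R []\<rparr>"

lemma word_class_eq_iff: "word_class R u = word_class R v \<longleftrightarrow> word_equiv R u v"
  unfolding word_class_def
  by (auto intro: word_equiv.refl word_equiv.sym word_equiv.trans)

lemma presented_group_mult:
  "word_class R u \<otimes>\<^bsub>presented_group R\<^esub> word_class R v = word_class R (u @ v)"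
proof -
  have "word_class R (u' @ v') = word_class R (u @ v)"
    if "u' \<in> word_class R u" "v' \<in> word_class R v" for u' v'
    using that by (simp add: word_class_def[of R u] word_class_def[of R v] word_class_eq_iff
        word_equiv.append word_equiv.sym)
  moreover have "u \<in> word_class R u" "v \<in> word_class R v"
    by (simp_all add: word_class_def word_equiv.refl)
  ultimately have "(\<Union>u'\<in>word_class R u. \<Union>v'\<in>word_class R v. word_class R (u' @ v')) =
      word_class R (u @ v)"
    by blast
  then show ?thesis by (simp add: presented_group_def)
qed

lemma presented_group_carrier: "carrier (presented_group R) = range (word_class R)"
  and presented_group_one: "\<one>\<^bsub>presented_group R\<^esub> = word_class R []"
  by (simp_all add: presented_group_def)

lemma word_equiv_inverse:
  "word_equiv R (rev (map (\<lambda>(x, b). (x, \<not> b)) w) @ w) []"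
proof (induction w)
  case Nil
  show ?case by (simp add: word_equiv.refl)
next
  case (Cons a w)
  obtain x b where a: "a = (x, b)" by (cases a)
  let ?v = "rev (map (\<lambda>(x, b). (x, \<not> b)) w)"
  have "word_equiv R [(x, \<not> b), (x, b)] []"
    using word_equiv.cancel[of R x "\<not> b"] by simp
  then have "word_equiv R (?v @ ([(x, \<not> b), (x, b)] @ w)) (?v @ ([] @ w))"
    by (intro word_equiv.append word_equiv.refl)
  then show ?case
    using Cons.IH by (auto simp: a intro: word_equiv.trans)
qed

lemma group_presented_group: "group (presented_group R)"
proof (rule groupI)
  fix X assume "X \<in> carrier (presented_group R)"
  then obtain w where w: "X = word_class R w" by (auto simp: presented_group_carrier)
  let ?v = "rev (map (\<lambda>(x, b). (x, \<not> b)) w)"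
  have "word_class R ?v \<otimes>\<^bsub>presented_group R\<^esub> X = \<one>\<^bsub>presented_group R\<^esub>"
    by (simp add: w presented_group_mult presented_group_one word_class_eq_iff word_equiv_inverse)
  then show "\<exists>Y\<in>carrier (presented_group R). Y \<otimes>\<^bsub>presented_group R\<^esub> X = \<one>\<^bsub>presented_group R\<^esub>"
    by (auto simp: presented_group_carrier)
next
  fix X Y Z
  assume "X \<in> carrier (presented_group R)" "Y \<in> carrier (presented_group R)"
    "Z \<in> carrier (presented_group R)"
  then obtain u v w where "X = word_class R u" "Y = word_class R v" "Z = word_class R w"
    by (auto simp: presented_group_carrier)
  then show "X \<otimes>\<^bsub>presented_group R\<^esub> Y \<otimes>\<^bsub>presented_group R\<^esub> Z =
      X \<otimes>\<^bsub>presented_group R\<^esub> (Y \<otimes>\<^bsub>presented_group R\<^esub> Z)"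
    by (simp add: presented_group_mult)
qed (auto simp: presented_group_carrier presented_group_one presented_group_mult)

definition word_value :: "('g, 'm) monoid_scheme \<Rightarrow> ('a \<Rightarrow> 'g) \<Rightarrow> 'a word \<Rightarrow> 'g" where
  "word_value G f w =
    foldr (\<lambda>(x, b) g. (if b then f x else inv\<^bsub>G\<^esub> (f x)) \<otimes>\<^bsub>G\<^esub> g) w \<one>\<^bsub>G\<^esub>"

lemma word_value_simps [simp]:
  "word_value G f [] = \<one>\<^bsub>G\<^esub>"
  "word_value G f ((x, b) # w) =
    (if b then f x else inv\<^bsub>G\<^esub> (f x)) \<otimes>\<^bsub>G\<^esub> word_value G f w"
  by (simp_all add: word_value_def)

lemma presented_group_universal:
  assumes G: "group G" and f: "\<And>x. f x \<in> carrier G"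
    and R: "\<And>r. r \<in> R \<Longrightarrow> word_value G f r = \<one>\<^bsub>G\<^esub>"
  shows "\<exists>\<phi>\<in>hom (presented_group R) G. \<forall>x. \<phi> (word_class R [(x, True)]) = f x"
proof -
  interpret group G by fact
  have closed: "word_value G f w \<in> carrier G" for w
    by (induction w) (auto simp: f)
  have app: "word_value G f (u @ v) = word_value G f u \<otimes>\<^bsub>G\<^esub> word_value G f v" for u v
    by (induction u) (auto simp: f closed m_assoc)
  have eq: "word_value G f u = word_value G f v" if "word_equiv R u v" for u v
    using that by induction (auto simp: app R f)
  define \<phi> where "\<phi> X = word_value G f (SOME w. w \<in> X)" for X
  have \<phi>: "\<phi> (word_class R w) = word_value G f w" for w
  proof -
    have "w \<in> word_class R w" by (simp add: word_class_def word_equiv.refl)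
    then have "(SOME v. v \<in> word_class R w) \<in> word_class R w" by (rule someI)
    then show ?thesis unfolding \<phi>_def using eq by (simp add: word_class_def)
  qed
  have "\<phi> \<in> hom (presented_group R) G"
    by (auto simp: hom_def presented_group_carrier presented_group_mult \<phi> closed app)
  then show ?thesis by (rule bexI[rotated]) (simp add: \<phi> f)
qed

definition group_center :: "('g, 'm) monoid_scheme \<Rightarrow> 'g set" where
  "group_center G = {z \<in> carrier G. \<forall>g\<in>carrier G. z \<otimes>\<^bsub>G\<^esub> g = g \<otimes>\<^bsub>G\<^esub> z}"


section \<open>Simply laced Coxeter groups\<close>

text \<open>A graph on the vertices of type \<open>'v\<close> is given by its set of edges, each an unordered pair.\<close>

definition coxeter_relators :: "'v set set \<Rightarrow> 'v word set" where
  "coxeter_relators E =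
    {concat (replicate 2 [(s, True)]) | s. True} \<union>
    {concat (replicate 3 [(s, True), (t, True)]) | s t. {s, t} \<in> E} \<union>
    {concat (replicate 2 [(s, True), (t, True)]) | s t. s \<noteq> t \<and> {s, t} \<notin> E}"

definition coxeter_group :: "'v set set \<Rightarrow> 'v word set monoid" where
  "coxeter_group E = presented_group (coxeter_relators E)"

definition coxeter_generator :: "'v set set \<Rightarrow> 'v \<Rightarrow> 'v word set" where
  "coxeter_generator E s = word_class (coxeter_relators E) [(s, True)]"


section \<open>The Vogan representation\<close>

definition general_linear :: "('k::field ^ 'v ^ 'v) monoid" where
  "general_linear = \<lparr>carrier = {A. invertible A}, mult = (**), one = mat 1\<rparr>"

text \<open>The characteristic vector of a vertex \<open>v\<close> is \<^term>\<open>axis v 1\<close>. The column of the matrix at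
  index \<open>v\<close> is the image of that vector.\<close>

definition vogan_image :: "'v set set \<Rightarrow> 'v \<Rightarrow> 'v \<Rightarrow> bit ^ ('v::finite)" where
  "vogan_image E s v =
    (if v = s then axis s 1 + (\<Sum>u\<in>{u. {u, s} \<in> E}. axis u 1) else axis v 1)"

definition vogan_matrix :: "'v set set \<Rightarrow> 'v \<Rightarrow> bit ^ ('v::finite) ^ 'v" where
  "vogan_matrix E s = (\<chi> i j. vogan_image E s j $ i)"

lemma vogan_matrix_axis: "vogan_matrix E s *v axis v 1 = vogan_image E s v"
  by (simp add: vogan_matrix_def vec_eq_iff matrix_vector_mult_def axis_def if_distrib
      sum.delta cong: if_cong)

definition vogan_representation ::
  "'v set set \<Rightarrow> ('v word set \<Rightarrow> bit ^ ('v::finite) ^ 'v) \<Rightarrow> bool" where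
  "vogan_representation E \<phi> \<longleftrightarrow>
    \<phi> \<in> hom (coxeter_group E) general_linear \<and>
    (\<forall>s. \<phi> (coxeter_generator E s) = vogan_matrix E s)"

lemma group_general_linear: "group (general_linear :: ('k::field ^ 'v::finite ^ 'v) monoid)"
proof (rule groupI)
  fix A :: "'k ^ 'v ^ 'v" assume "A \<in> carrier general_linear"
  then obtain B where "A ** B = mat 1" "B ** A = mat 1"
    by (auto simp: general_linear_def invertible_def)
  then show "\<exists>B\<in>carrier general_linear. B \<otimes>\<^bsub>general_linear\<^esub> A = \<one>\<^bsub>general_linear\<^esub>"
    by (auto simp: general_linear_def invertible_def)
next
  fix A B :: "'k ^ 'v ^ 'v"
  assume "A \<in> carrier general_linear" "B \<in> carrier general_linear"
  then show "A \<otimes>\<^bsub>general_linear\<^esub> B \<in> carrier general_linear"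
    by (simp add: general_linear_def invertible_mult)
next
  show "\<one>\<^bsub>general_linear\<^esub> \<in> carrier (general_linear :: ('k ^ 'v ^ 'v) monoid)"
    unfolding general_linear_def invertible_def
    by (auto intro: exI[of _ "mat 1 :: 'k ^ 'v ^ 'v"])
qed (simp_all add: general_linear_def matrix_mul_assoc)

lemma sum_two_entries:
  fixes x :: "'i::finite \<Rightarrow> 'a::semiring_1"
  shows "(\<Sum>j\<in>UNIV. ((if i = j then 1 else 0) + (if j = s \<and> P then 1 else 0)) * x j) =
    x i + (if P then x s else 0)"
  by (cases P) (simp_all add: distrib_right sum.distrib if_distrib[of "\<lambda>c. c * _"] cong: if_cong)

lemma vogan_matrix_vector:
  fixes x :: "bit ^ 'v::finite"
  assumes "{s} \<notin> E"
  shows "(vogan_matrix E s *v x) $ i = x $ i + (if {i, s} \<in> E then x $ s else 0)"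
proof -
  have "vogan_image E s j $ i =
      (if i = j then 1 else 0) + (if j = s \<and> {i, s} \<in> E then 1 else 0)" for j
    using assms by (auto simp: vogan_image_def axis_def if_distrib sum.delta cong: if_cong)
  then show ?thesis
    by (simp only: matrix_vector_mult_def vogan_matrix_def vec_lambda_beta sum_two_entries)
qed

lemma vogan_representation_exists:
  fixes E :: "'v::finite set set"
  assumes loopless: "\<And>s. {s} \<notin> E"
  shows "\<exists>\<phi>. vogan_representation E \<phi>"
proof -
  let ?A = "vogan_matrix E"
  have sw: "{s, t} \<in> E \<longleftrightarrow> {t, s} \<in> E" for s t by (simp add: insert_commute)
  have matI: "A = mat 1" if "\<And>x i. (A *v x) $ i = x $ i" for A :: "bit ^ 'v ^ 'v"
    using that by (simp add: matrix_eq vec_eq_iff)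
  note act = matrix_vector_mul_assoc[symmetric] vogan_matrix_vector[OF loopless]
  have sq: "?A s ** ?A s = mat 1" for s
  proof (rule matI)
    fix x i
    show "((?A s ** ?A s) *v x) $ i = x $ i"
      by (cases "x $ s = 0"; cases "x $ i = 0") (simp_all add: act loopless)
  qed
  have cube: "?A s ** (?A t ** (?A s ** (?A t ** (?A s ** ?A t)))) = mat 1" if "{s, t} \<in> E" for s t
  proof (rule matI)
    fix x i
    show "((?A s ** (?A t ** (?A s ** (?A t ** (?A s ** ?A t))))) *v x) $ i = x $ i"
      using that sw[of s t]
      by (cases "x $ s = 0"; cases "x $ t = 0"; cases "x $ i = 0") (simp_all add: act loopless)
  qed
  have comm: "?A s ** (?A t ** (?A s ** ?A t)) = mat 1" if "{s, t} \<notin> E" for s t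
  proof (rule matI)
    fix x i
    show "((?A s ** (?A t ** (?A s ** ?A t))) *v x) $ i = x $ i"
      using that sw[of s t]
      by (cases "x $ s = 0"; cases "x $ t = 0"; cases "x $ i = 0") (simp_all add: act loopless)
  qed
  have inv: "invertible (?A s)" for s
    unfolding invertible_def using sq by blast
  have "\<exists>\<phi>\<in>hom (presented_group (coxeter_relators E)) general_linear.
      \<forall>s. \<phi> (word_class (coxeter_relators E) [(s, True)]) = ?A s"
  proof (rule presented_group_universal[OF group_general_linear])
    show "?A s \<in> carrier general_linear" for s
      by (simp add: general_linear_def inv)
    show "word_value general_linear ?A r = \<one>\<^bsub>general_linear\<^esub>" if "r \<in> coxeter_relators E" for r
      using that
      by (auto simp: coxeter_relators_def general_linear_def numeral_eq_Suc sq cube comm)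
  qed
  then show ?thesis
    by (auto simp: vogan_representation_def coxeter_group_def coxeter_generator_def)
qed


section \<open>Type \<open>E\<^sub>8\<close>\<close>

datatype e8_vertex = S1 | S2 | S3 | S4 | S5 | S6 | S7 | S8

instance e8_vertex :: finite
proof
  have "UNIV = {S1, S2, S3, S4, S5, S6, S7, S8}"
    using e8_vertex.exhaust by blast
  then show "finite (UNIV :: e8_vertex set)"
    by (metis finite.emptyI finite.insertI)
qed

definition e8_graph :: "e8_vertex set set" where
  "e8_graph = {{S1, S2}, {S2, S3}, {S3, S4}, {S4, S5}, {S5, S6}, {S6, S7}, {S5, S8}}"

lemma e8_vogan_representation_exists: "\<exists>\<phi>. vogan_representation e8_graph \<phi>"
  by (rule vogan_representation_exists) (auto simp: e8_graph_def)

end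

theory Submission
  imports Defs
begin

text \<open>The reflection representation on the root lattice is faithful by Tits' positivity argument, and
  the Vogan representation is the reduction modulo 2 of its contragredient. If \<open>w\<close> lies in the kernel,
  every root \<open>\<alpha>\<close> is congruent to \<open>w \<alpha>\<close> modulo 2. As the form is even and positive definite, this forces
  \<open>w \<alpha> = \<alpha>\<close> or \<open>w \<alpha> = - \<alpha>\<close>, and the sign is the same for all simple roots. So \<open>w\<close> acts as 1 or as
  -1, and -1 is a power of a Coxeter element. Conversely a matrix over the two-element field that
  commutes with all Vogan matrices is diagonal, so the center lies in the kernel.\<close>

section \<open>Words in simply laced Coxeter groups\<close>

declare word_equiv.trans [trans]

text \<open>This serves to compare two words by reducing a common longer word in two ways.\<close>

lemma word_equiv_euclidean: "word_equiv R w u \<Longrightarrow> word_equiv R w v \<Longrightarrow> word_equiv R u v"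
  by (rule word_equiv.trans[OF word_equiv.sym])

lemma word_equiv_context: "word_equiv R u v \<Longrightarrow> word_equiv R (p @ u @ q) (p @ v @ q)"
  by (intro word_equiv.append word_equiv.refl)

lemma coxeter_word_square: "word_equiv (coxeter_relators E) [(s, b), (s, c)] []"
proof -
  let ?R = "coxeter_relators E"
  have TT: "word_equiv ?R [(s, True), (s, True)] []"
    by (rule word_equiv.relator) (auto simp: coxeter_relators_def numeral_eq_Suc)
  have c: "word_equiv ?R [(s, b), (s, \<not> b)] []" for b
    by (rule word_equiv.cancel)
  have FF: "word_equiv ?R [(s, False), (s, False)] []"
  proof (rule word_equiv_euclidean)
    \<comment> \<open>The same four letters reduce from the middle by the relator, or in two outer
      pairs by free cancellation.\<close>
    show "word_equiv ?R [(s, False), (s, True), (s, True), (s, False)] [(s, False), (s, False)]"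
      using word_equiv_context[OF TT, of "[(s, False)]" "[(s, False)]"] by simp
    show "word_equiv ?R [(s, False), (s, True), (s, True), (s, False)] []"
      using word_equiv.append[OF c[of False] c[of True]] by simp
  qed
  show ?thesis using TT FF c[of True] c[of False] by (cases b; cases c) auto
qed

lemma coxeter_word_letter: "word_equiv (coxeter_relators E) [(s, b)] [(s, c)]"
proof (rule word_equiv_euclidean)
  show "word_equiv (coxeter_relators E) [(s, b), (s, c), (s, c)] [(s, b)]"
    using word_equiv_context[OF coxeter_word_square, of E "[(s, b)]" s c c "[]"] by simp
  show "word_equiv (coxeter_relators E) [(s, b), (s, c), (s, c)] [(s, c)]"
    using word_equiv_context[OF coxeter_word_square, of E "[]" s b c "[(s, c)]"] by simp
qed

text \<open>Generators are involutions, so reversal already inverts a word and the signs of the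
  letters may stay.\<close>

lemma coxeter_word_rev: "word_equiv (coxeter_relators E) (w @ rev w) []"
proof (induction w)
  case Nil
  show ?case by (simp add: word_equiv.refl)
next
  case (Cons a w)
  have "word_equiv (coxeter_relators E) ((a # w) @ rev (a # w)) [a, a]"
    using word_equiv_context[OF Cons.IH, of "[a]" "[a]"] by simp
  also have "word_equiv (coxeter_relators E) [a, a] []"
    using coxeter_word_square[of E "fst a" "snd a" "snd a"] by simp
  finally show ?case .
qed

text \<open>The relator is \<open>?u @ ?v\<close>, and \<open>?v\<close> is a palindrome, hence its
  own inverse. So \<open>?u @ ?v @ ?v\<close> reduces both to \<open>?v\<close> and to
  \<open>?u\<close>.\<close>

lemma coxeter_word_braid:
  assumes "{s, t} \<in> E"
  shows "word_equiv (coxeter_relators E)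
    [(s, True), (t, True), (s, True)] [(t, True), (s, True), (t, True)]"
    (is "word_equiv ?R ?u ?v")
proof (rule word_equiv_euclidean)
  have "word_equiv ?R (?u @ ?v) []"
    by (rule word_equiv.relator) (use assms in \<open>force simp: coxeter_relators_def numeral_eq_Suc\<close>)
  from word_equiv_context[OF this, of "[]" ?v] show "word_equiv ?R (?u @ ?v @ ?v) ?v"
    by simp
next
  show "word_equiv ?R (?u @ ?v @ ?v) ?u"
    using word_equiv_context[OF coxeter_word_rev, of E ?u ?v "[]"] by simp
qed

lemma coxeter_word_commute:
  assumes "s \<noteq> t" "{s, t} \<notin> E"
  shows "word_equiv (coxeter_relators E) [(s, True), (t, True)] [(t, True), (s, True)]"
    (is "word_equiv ?R ?u ?v")
proof (rule word_equiv_euclidean)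
  have "word_equiv ?R (?u @ ?u) []"
    by (rule word_equiv.relator) (use assms in \<open>force simp: coxeter_relators_def numeral_eq_Suc\<close>)
  from word_equiv_context[OF this, of "[]" ?v] show "word_equiv ?R (?u @ ?u @ ?v) ?v"
    by simp
  show "word_equiv ?R (?u @ ?u @ ?v) ?u"
    using word_equiv_context[OF coxeter_word_rev, of E ?u ?u "[]"] by simp
qed

section \<open>Coxeter length and descents\<close>

definition word_length :: "'a word set \<Rightarrow> 'a word \<Rightarrow> nat" where
  "word_length R w = (LEAST n. \<exists>v. word_equiv R w v \<and> length v = n)"

lemma word_length_le: "word_equiv R w v \<Longrightarrow> word_length R w \<le> length v"
  unfolding word_length_def by (rule Least_le) blast

lemma word_length_witness: "\<exists>v. word_equiv R w v \<and> length v = word_length R w"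
  unfolding word_length_def by (rule LeastI_ex) (auto intro: word_equiv.refl)

lemma word_length_cong:
  assumes "word_equiv R u v"
  shows "word_length R u = word_length R v"
proof -
  have "word_equiv R u w \<longleftrightarrow> word_equiv R v w" for w
    using assms word_equiv_euclidean word_equiv.trans by metis
  then show ?thesis by (simp add: word_length_def)
qed

lemma word_length_append: "word_length R (u @ v) \<le> word_length R u + length v"
proof -
  obtain u' where u': "word_equiv R u u'" "length u' = word_length R u"
    using word_length_witness by blast
  then have "word_equiv R (u @ v) (u' @ v)"
    by (intro word_equiv.append word_equiv.refl)
  from word_length_le[OF this] u'(2) show ?thesis by simp
qed

lemma word_equiv_append_square:
  "word_equiv (coxeter_relators E) (w @ [(s, b), (s, c)]) w"
  using word_equiv.append[OF word_equiv.refl[of _ w] coxeter_word_square[of E s b c]] by simp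

text \<open>The last letter of a shortest representative is a descent.\<close>

lemma coxeter_word_descent:
  assumes "word_length (coxeter_relators E) w \<noteq> 0"
  shows "\<exists>t. word_length (coxeter_relators E) (w @ [(t, True)]) < word_length (coxeter_relators E) w"
proof -
  obtain v where v: "word_equiv (coxeter_relators E) w v"
    "length v = word_length (coxeter_relators E) w"
    using word_length_witness by blast
  with assms obtain v' t b where v': "v = v' @ [(t, b)]"
    by (cases v rule: rev_cases) auto
  have "word_equiv (coxeter_relators E) (w @ [(t, True)]) (v' @ [(t, b), (t, True)])"
    using word_equiv.append[OF v(1) word_equiv.refl[of _ "[(t, True)]"]] v' by simp
  then have "word_equiv (coxeter_relators E) (w @ [(t, True)]) v'"
    by (rule word_equiv.trans[OF _ word_equiv_append_square])
  from word_length_le[OF this] v(2) v'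
  have "word_length (coxeter_relators E) (w @ [(t, True)]) < word_length (coxeter_relators E) w"
    by simp
  then show ?thesis ..
qed


section \<open>The reflection representation over the integers\<close>

lemma matrix_eqI_nth:
  fixes A B :: "'a::semiring_1 ^ 'n ^ 'm"
  assumes "\<And>x i. (A *v x) $ i = (B *v x) $ i"
  shows "A = B"
  using assms by (simp add: matrix_eq vec_eq_iff)

lemma matrix_vector_axis: "(A *v axis j 1) $ i = A $ i $ j"
  by (simp add: matrix_vector_mult_def axis_def if_distrib cong: if_cong)

locale loopless_graph =
  fixes E :: "'v::finite set set"
  assumes loopless: "{s} \<notin> E"
begin

abbreviation coxeter_equiv :: "'v word \<Rightarrow> 'v word \<Rightarrow> bool" (infix "\<approx>" 50) where
  "u \<approx> v \<equiv> word_equiv (coxeter_relators E) u v"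

abbreviation len :: "'v word \<Rightarrow> nat" where
  "len \<equiv> word_length (coxeter_relators E)"

text \<open>The contragredient reflection, in the basis dual to the simple roots. Modulo 2 the entry
  -1 becomes 1 and the Vogan matrix appears.\<close>

definition dual_reflection :: "'v \<Rightarrow> int ^ 'v ^ 'v" where
  "dual_reflection s = (\<chi> i j.
    if i = j then (if i = s then - 1 else 1) else if j = s \<and> {i, s} \<in> E then 1 else 0)"

text \<open>Here \<open>axis s 1\<close> stands for the simple root of \<open>s\<close>. The
  relations are checked on the dual side, where the coordinate formula contains no sum, and then
  transposed.\<close>

definition reflection :: "'v \<Rightarrow> int ^ 'v ^ 'v" where
  "reflection s = transpose (dual_reflection s)"

text \<open>The exponent of a letter is ignored, since each reflection is its own inverse.\<close>

definition root_matrix :: "'v word \<Rightarrow> int ^ 'v ^ 'v" where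
  "root_matrix w = foldr (\<lambda>(s, _) A. reflection s ** A) w (mat 1)"

lemma dual_reflection_vector:
  "(dual_reflection s *v x) $ i =
    (if i = s then - x $ s else x $ i + (if {i, s} \<in> E then x $ s else 0))"
proof -
  have "dual_reflection s $ i $ j * x $ j =
      (if i = j then (if i = s then - 1 else 1) * x $ j else 0) +
      (if s = j then (if i \<noteq> s \<and> {i, s} \<in> E then x $ j else 0) else 0)" for j
    by (simp add: dual_reflection_def)
  then show ?thesis
    by (simp add: matrix_vector_mult_def sum.distrib)
qed

lemma reflection_vector:
  "(reflection s *v x) $ i =
    (if i = s then (\<Sum>t | {t, s} \<in> E. x $ t) - x $ s else x $ i)"
proof -
  have "reflection s $ i $ j * x $ j =
      (if i = s then (if {j, s} \<in> E then x $ j else 0) else 0) +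
      (if i = j then (if i = s then - x $ j else x $ j) else 0)" for j
    by (auto simp: reflection_def transpose_def dual_reflection_def loopless)
  then show ?thesis
    by (simp add: matrix_vector_mult_def sum.distrib sum.If_cases)
qed

lemma reflection_axis:
  "reflection s *v axis t 1 =
    (if s = t then - axis s 1 else if {s, t} \<in> E then axis t 1 + axis s 1 else axis t 1)"
proof -
  have "(\<Sum>i | {i, s} \<in> E. axis t (1::int) $ i) = (if {t, s} \<in> E then 1 else 0)"
    by (simp add: axis_def)
  then show ?thesis
    by (simp add: vec_eq_iff reflection_vector) (auto simp: axis_def loopless insert_commute)
qed

lemma reflection_square: "reflection s ** reflection s = mat 1"
proof -
  have "dual_reflection s ** dual_reflection s = mat 1"
    by (rule matrix_eqI_nth)
      (simp add: matrix_vector_mul_assoc[symmetric] dual_reflection_vector)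
  then show ?thesis
    by (metis reflection_def matrix_transpose_mul transpose_mat)
qed

lemma reflection_braid:
  assumes "{s, t} \<in> E"
  shows "reflection s ** (reflection t ** reflection s) =
    reflection t ** (reflection s ** reflection t)"
proof -
  have "s \<noteq> t" using assms loopless by auto
  moreover have "{t, s} \<in> E" using assms by (simp add: insert_commute)
  ultimately have "dual_reflection s ** dual_reflection t ** dual_reflection s =
      dual_reflection t ** dual_reflection s ** dual_reflection t"
    using assms by (intro matrix_eqI_nth)
      (simp add: matrix_vector_mul_assoc[symmetric] dual_reflection_vector)
  from arg_cong[OF this, of transpose] show ?thesis
    by (simp add: reflection_def matrix_transpose_mul)
qed

lemma reflection_commute:
  assumes "{s, t} \<notin> E"
  shows "reflection s ** reflection t = reflection t ** reflection s"
proof -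
  have "{t, s} \<notin> E" using assms by (simp add: insert_commute)
  then have "dual_reflection s ** dual_reflection t = dual_reflection t ** dual_reflection s"
    using assms by (intro matrix_eqI_nth)
      (simp add: matrix_vector_mul_assoc[symmetric] dual_reflection_vector)
  from arg_cong[OF this, of transpose] show ?thesis
    by (simp add: reflection_def matrix_transpose_mul)
qed

lemma root_matrix_Nil [simp]: "root_matrix [] = mat 1"
  and root_matrix_Cons [simp]: "root_matrix ((s, b) # w) = reflection s ** root_matrix w"
  by (simp_all add: root_matrix_def)

lemma root_matrix_append: "root_matrix (u @ v) = root_matrix u ** root_matrix v"
  by (induction u) (auto simp: matrix_mul_assoc)

lemma root_matrix_relator:
  assumes "r \<in> coxeter_relators E"
  shows "root_matrix r = mat 1"
proof -
  have braid: "reflection s ** (reflection t ** (reflection s ** (reflection t **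
      (reflection s ** reflection t)))) = mat 1" if "{s, t} \<in> E" for s t
    by (metis reflection_braid[OF that] reflection_square matrix_mul_assoc matrix_mul_rid)
  have commute: "reflection s ** (reflection t ** (reflection s ** reflection t)) = mat 1"
    if "{s, t} \<notin> E" for s t
    by (metis reflection_commute[OF that] reflection_square matrix_mul_assoc matrix_mul_rid)
  show ?thesis using assms
    by (auto simp: coxeter_relators_def numeral_eq_Suc reflection_square braid commute)
qed

lemma root_matrix_cong: "u \<approx> v \<Longrightarrow> root_matrix u = root_matrix v"
  by (induction rule: word_equiv.induct)
    (simp_all add: root_matrix_append root_matrix_relator reflection_square)

lemma root_matrix_rev: "root_matrix w ** root_matrix (rev w) = mat 1"
  using root_matrix_cong[OF coxeter_word_rev] by (simp add: root_matrix_append)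

text \<open>Tits' argument: in the simply laced case the passage to a dihedral subgroup amounts to
  stripping at most three letters \<open>s\<close>, \<open>t\<close> from the right end of \<open>w\<close>.\<close>

lemma root_nonneg:
  assumes "len w \<le> len (w @ [(s, True)])"
  shows "0 \<le> (root_matrix w *v axis s 1) $ i"
  using assms
proof (induction "len w" arbitrary: w s i rule: less_induct)
  case less
  show ?case
  proof (cases "len w = 0")
    case True
    then have "w \<approx> []" using word_length_witness[of "coxeter_relators E" w] by auto
    then show ?thesis using root_matrix_cong by (force simp: axis_def)
  next
    case False
    then obtain t where t: "len (w @ [(t, True)]) < len w"
      using coxeter_word_descent by blast
    then have st: "s \<noteq> t" using less.prems by auto
    define w' where "w' = w @ [(t, True)]"
    have w: "w \<approx> w' @ [(t, True)]"
      using word_equiv.sym[OF word_equiv_append_square] by (simp add: w'_def)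
    have lw': "len w' < len w" using t by (simp add: w'_def)
    have Aw: "root_matrix w *v x = root_matrix w' *v (reflection t *v x)" for x
      using root_matrix_cong[OF w] by (simp add: root_matrix_append matrix_vector_mul_assoc)
    have ws: "w @ [(s, True)] \<approx> w' @ [(t, True), (s, True)]"
      using word_equiv.append[OF w word_equiv.refl[of _ "[(s, True)]"]] by simp
    show ?thesis
    proof (cases "{s, t} \<in> E")
      case nonadj: False
      have "w' @ [(t, True), (s, True)] \<approx> w' @ [(s, True), (t, True)]"
        using coxeter_word_commute[of t s] st nonadj
        by (intro word_equiv.append word_equiv.refl) (auto simp: insert_commute)
      from word_equiv.trans[OF ws this]
      have "w @ [(s, True)] \<approx> (w' @ [(s, True)]) @ [(t, True)]" by simp
      \<comment> \<open>If \<open>s\<close> were a descent of \<open>w'\<close>, this bound would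
        make \<open>w @ [(s, True)]\<close> shorter than \<open>w\<close>. So induction applies to
        \<open>w'\<close> and \<open>s\<close>, and the reflection in \<open>t\<close> fixes the
        simple root of \<open>s\<close>.\<close>
      then have "len (w @ [(s, True)]) \<le> len (w' @ [(s, True)]) + 1"
        using word_length_cong word_length_append[of "coxeter_relators E" "w' @ [(s, True)]" "[(t, True)]"]
        by fastforce
      then have "len w' \<le> len (w' @ [(s, True)])" using less.prems lw' by linarith
      from less.hyps[OF lw' this] show ?thesis
        using nonadj st by (simp add: Aw reflection_axis insert_commute)
    next
      case adj: True
      have wt: "len w' \<le> len (w' @ [(t, True)])"
        using lw' word_length_cong[OF w] by simp
      have Aws: "root_matrix w *v axis s 1 = root_matrix w' *v (axis s 1 + axis t 1)"
        using adj st by (simp add: Aw reflection_axis insert_commute)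
      show ?thesis
      \<comment> \<open>If \<open>s\<close> too is an ascent of \<open>w'\<close>, induction makes
        both summands in \<open>Aws\<close> nonnegative. Otherwise \<open>s\<close> is stripped as
        well, which turns the sum of the two simple roots into that of \<open>t\<close>.\<close>
      proof (cases "len w' \<le> len (w' @ [(s, True)])")
        case True
        from less.hyps[OF lw' this, of i] less.hyps[OF lw' wt, of i] show ?thesis
          by (simp add: Aws matrix_vector_right_distrib)
      next
        case False
        define w'' where "w'' = w' @ [(s, True)]"
        have w': "w' \<approx> w'' @ [(s, True)]"
          using word_equiv.sym[OF word_equiv_append_square] by (simp add: w''_def)
        have lw'': "len w'' < len w'" using False by (simp add: w''_def)
        have "root_matrix w *v axis s 1 = root_matrix w'' *v (reflection s *v (axis s 1 + axis t 1))"
          using root_matrix_cong[OF w'] by (simp add: Aws root_matrix_append matrix_vector_mul_assoc)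
        also have "reflection s *v (axis s 1 + axis t 1) = axis t 1"
          using adj st by (simp add: matrix_vector_right_distrib reflection_axis)
        finally have eq: "root_matrix w *v axis s 1 = root_matrix w'' *v axis t 1" .
        note ws
        also have "w' @ [(t, True), (s, True)] \<approx> w'' @ [(s, True), (t, True), (s, True)]"
          using word_equiv.append[OF w' word_equiv.refl[of _ "[(t, True), (s, True)]"]] by simp
        also have "w'' @ [(s, True), (t, True), (s, True)] \<approx> w'' @ [(t, True), (s, True), (t, True)]"
          by (intro word_equiv.append word_equiv.refl coxeter_word_braid adj)
        finally have "w @ [(s, True)] \<approx> (w'' @ [(t, True)]) @ [(s, True), (t, True)]"
          by simp
        \<comment> \<open>The braid relation gives this bound. A descent \<open>t\<close> of
          \<open>w''\<close> would then force \<open>s\<close> to be a descent of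
          \<open>w\<close>.\<close>
        then have "len (w @ [(s, True)]) \<le> len (w'' @ [(t, True)]) + 2"
          using word_length_cong
            word_length_append[of "coxeter_relators E" "w'' @ [(t, True)]" "[(s, True), (t, True)]"]
          by fastforce
        then have "len w'' \<le> len (w'' @ [(t, True)])" using less.prems lw' lw'' by linarith
        from less.hyps[OF _ this] lw' lw'' show ?thesis by (simp add: eq)
      qed
    qed
  qed
qed

text \<open>If \<open>t\<close> is a descent of \<open>w\<close>, it is an ascent of
  \<open>w @ [(t, True)]\<close>, which must then send the simple root of \<open>t\<close> to a
  nonnegative vector. When \<open>w\<close> acts trivially that image is the negative of the simple
  root.\<close>

lemma root_matrix_trivial:
  assumes "root_matrix w = mat 1"
  shows "w \<approx> []"
proof (cases "len w = 0")
  case True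
  then show ?thesis using word_length_witness[of "coxeter_relators E" w] by auto
next
  case False
  then obtain t where t: "len (w @ [(t, True)]) < len w"
    using coxeter_word_descent by blast
  have "(w @ [(t, True)]) @ [(t, True)] \<approx> w"
    using word_equiv_append_square by simp
  from word_length_cong[OF this] t
  have "len (w @ [(t, True)]) \<le> len ((w @ [(t, True)]) @ [(t, True)])"
    by simp
  from root_nonneg[OF this, of t] have "0 \<le> ((- axis t 1) :: int ^ 'v) $ t"
    using assms by (simp only: root_matrix_append root_matrix_Cons root_matrix_Nil
        matrix_mul_lid matrix_mul_rid reflection_axis if_True simp_thms)
  then have False by (simp add: axis_def)
  then show ?thesis ..
qed

lemma root_matrix_faithful: "root_matrix u = root_matrix v \<longleftrightarrow> u \<approx> v"
proof
  assume eq: "root_matrix u = root_matrix v"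
  have "root_matrix (u @ rev v) = mat 1"
    by (simp add: root_matrix_append eq root_matrix_rev)
  then have "u @ rev v \<approx> []" by (rule root_matrix_trivial)
  from word_equiv_context[OF this, of "[]" v] have "u @ rev v @ v \<approx> v" by simp
  moreover have "u @ rev v @ v \<approx> u"
    using word_equiv_context[OF coxeter_word_rev, of E u "rev v" "[]"] by simp
  ultimately show "u \<approx> v" by (rule word_equiv_euclidean[rotated])
qed (rule root_matrix_cong)

section \<open>Reduction modulo 2 and the commutant of the Vogan matrices\<close>

definition transpose_mod2 :: "int ^ 'v ^ 'v \<Rightarrow> bit ^ 'v ^ 'v" where
  "transpose_mod2 A = (\<chi> i j. of_int (A $ j $ i))"

lemma transpose_mod2_mult: "transpose_mod2 (A ** B) = transpose_mod2 B ** transpose_mod2 A"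
  by (simp add: transpose_mod2_def matrix_matrix_mult_def vec_eq_iff conj_commute)

lemma transpose_mod2_mat_1: "transpose_mod2 (mat 1) = mat 1"
  by (simp add: transpose_mod2_def mat_def vec_eq_iff)

lemma transpose_mod2_reflection: "transpose_mod2 (reflection s) = vogan_matrix E s"
proof -
  have "vogan_image E s j $ i =
      (if j = s then (if i = s then 1 else if {i, s} \<in> E then 1 else 0) else if i = j then 1 else 0)"
    for i j
    by (auto simp: vogan_image_def axis_def loopless)
  then show ?thesis
    by (auto simp: vec_eq_iff transpose_mod2_def reflection_def transpose_def
        dual_reflection_def vogan_matrix_def)
qed

text \<open>Transposition reverses products, and reversing the word compensates for this.\<close>

lemma vogan_representation_word:
  assumes "vogan_representation E \<phi>"
  shows "\<phi> (word_class (coxeter_relators E) w) = transpose_mod2 (root_matrix (rev w))"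
proof (induction w)
  case Nil
  interpret G: group "coxeter_group E"
    unfolding coxeter_group_def by (rule group_presented_group)
  interpret H: group "general_linear :: (bit ^ 'v ^ 'v) monoid"
    by (rule group_general_linear)
  have "\<phi> \<one>\<^bsub>coxeter_group E\<^esub> = \<one>\<^bsub>general_linear\<^esub>"
    using assms hom_one[OF _ G.is_group H.is_group] by (auto simp: vogan_representation_def)
  then show ?case
    by (simp add: coxeter_group_def presented_group_one general_linear_def transpose_mod2_mat_1)
next
  case (Cons a w)
  obtain s b where a: "a = (s, b)" by (cases a)
  let ?c = "word_class (coxeter_relators E)"
  have "?c (a # w) = ?c ([(s, True)] @ w)"
    unfolding word_class_eq_iff a
    using word_equiv.append[OF coxeter_word_letter[of E s b True] word_equiv.refl[of _ w]] by simp
  also have "\<dots> = ?c [(s, True)] \<otimes>\<^bsub>coxeter_group E\<^esub> ?c w"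
    by (simp add: coxeter_group_def presented_group_mult)
  also have "\<phi> \<dots> = \<phi> (?c [(s, True)]) \<otimes>\<^bsub>general_linear\<^esub> \<phi> (?c w)"
    using assms by (intro hom_mult[of _ "coxeter_group E"])
      (auto simp: vogan_representation_def coxeter_group_def presented_group_carrier)
  also have "\<dots> = vogan_matrix E s ** \<phi> (?c w)"
    using assms
    by (simp add: vogan_representation_def coxeter_generator_def general_linear_def)
  finally show ?case
    by (simp add: a Cons.IH root_matrix_append transpose_mod2_mult transpose_mod2_reflection)
qed

text \<open>This turns membership in the kernel into the congruence of each root with its
  image.\<close>

lemma transpose_mod2_eq_mat_1:
  assumes "transpose_mod2 A = mat 1"
  shows "even ((A *v x) $ i - x $ i)"
proof -
  have "(of_int (A $ i $ j) :: bit) = (if i = j then 1 else 0)" for j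
    using assms by (simp add: transpose_mod2_def mat_def vec_eq_iff)
  then have "(of_int (A $ i $ j * x $ j) :: bit) = (if i = j then of_int (x $ j) else 0)" for j
    by simp
  then have "(of_int ((A *v x) $ i - x $ i) :: bit) = 0"
    by (simp only: matrix_vector_mult_def vec_lambda_beta of_int_diff of_int_sum) simp
  moreover have "(of_int k :: bit) = 1" if "odd k" for k
    using that by (elim oddE) simp
  ultimately show ?thesis by fastforce
qed

text \<open>For \<open>j \<noteq> s\<close> the Vogan matrix of \<open>s\<close> fixes
  \<open>axis j 1\<close>, hence also column \<open>j\<close> of \<open>A\<close>. At a neighbour of
  \<open>s\<close> this forces entry \<open>s\<close> of the column to vanish. So \<open>A\<close>
  is diagonal, and an invertible diagonal matrix over two elements is the identity.\<close>

lemma commutes_with_vogan_matrices: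
  assumes inv: "invertible A"
    and comm: "\<And>s. A ** vogan_matrix E s = vogan_matrix E s ** A"
    and neighbour: "\<And>s. \<exists>t. {t, s} \<in> E"
  shows "A = mat 1"
proof -
  have off: "A $ s $ j = 0" if "j \<noteq> s" for s j
  proof -
    obtain t where t: "{t, s} \<in> E" using neighbour by blast
    have "vogan_matrix E s *v (A *v axis j 1) = A *v (vogan_matrix E s *v axis j 1)"
      by (simp add: matrix_vector_mul_assoc comm)
    also have "vogan_matrix E s *v axis j 1 = axis j 1"
      using that by (simp add: vogan_matrix_axis vogan_image_def)
    finally have "(vogan_matrix E s *v (A *v axis j 1)) $ t = (A *v axis j 1) $ t" by simp
    then have "A $ t $ j + A $ s $ j = A $ t $ j"
      using t by (simp only: vogan_matrix_vector[OF loopless] matrix_vector_axis if_True)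
    then show ?thesis by (metis add_cancel_right_right)
  qed
  have diag: "A $ j $ j = 1" for j
  proof (rule ccontr)
    assume "A $ j $ j \<noteq> 1"
    then have "A $ i $ j = 0" for i
      using off[of j i] by (cases "i = j") auto
    then have "A *v axis j 1 = 0"
      by (simp add: vec_eq_iff matrix_vector_axis)
    moreover obtain B where "B ** A = mat 1"
      using inv by (auto simp: invertible_def)
    then have "B *v (A *v axis j 1) = axis j 1"
      by (simp add: matrix_vector_mul_assoc)
    ultimately have "axis j (1 :: bit) = 0"
      by simp
    then show False by (simp add: axis_eq_0_iff)
  qed
  show ?thesis using off diag by (auto simp: vec_eq_iff mat_def)
qed

end


section \<open>The root lattice of type \<open>E\<^sub>8\<close>\<close>

interpretation e8: loopless_graph e8_graph
  by unfold_locales (auto simp: e8_graph_def)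

lemma e8_neighbours:
  "{t. {t, S1} \<in> e8_graph} = {S2}"
  "{t. {t, S2} \<in> e8_graph} = {S1, S3}"
  "{t. {t, S3} \<in> e8_graph} = {S2, S4}"
  "{t. {t, S4} \<in> e8_graph} = {S3, S5}"
  "{t. {t, S5} \<in> e8_graph} = {S4, S6, S8}"
  "{t. {t, S6} \<in> e8_graph} = {S5, S7}"
  "{t. {t, S7} \<in> e8_graph} = {S6}"
  "{t. {t, S8} \<in> e8_graph} = {S5}"
  by (auto simp: e8_graph_def doubleton_eq_iff)

text \<open>Half of the invariant even form, so that roots have value 1.\<close>

definition e8_form :: "int ^ e8_vertex \<Rightarrow> int" where
  "e8_form x =
    (x $ S1)\<^sup>2 + (x $ S2)\<^sup>2 + (x $ S3)\<^sup>2 + (x $ S4)\<^sup>2 +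
    (x $ S5)\<^sup>2 + (x $ S6)\<^sup>2 + (x $ S7)\<^sup>2 + (x $ S8)\<^sup>2 -
    x $ S1 * x $ S2 - x $ S2 * x $ S3 - x $ S3 * x $ S4 - x $ S4 * x $ S5 -
    x $ S5 * x $ S6 - x $ S6 * x $ S7 - x $ S5 * x $ S8"

lemma e8_form_reflection: "e8_form (e8.reflection s *v x) = e8_form x"
  by (cases s)
    (simp_all add: e8_form_def e8.reflection_vector e8_neighbours power2_eq_square algebra_simps)

lemma e8_form_root_matrix: "e8_form (e8.root_matrix w *v x) = e8_form x"
  by (induction w)
    (auto simp: e8_form_reflection matrix_vector_mul_assoc[symmetric])

text \<open>Completing squares along the three arms of the graph, towards the branch vertex.\<close>

lemma e8_form_squares:
  "120 * e8_form x =
    30 * (2 * x $ S1 - x $ S2)\<^sup>2 + 10 * (3 * x $ S2 - 2 * x $ S3)\<^sup>2 +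
    5 * (4 * x $ S3 - 3 * x $ S4)\<^sup>2 + 3 * (5 * x $ S4 - 4 * x $ S5)\<^sup>2 +
    30 * (2 * x $ S7 - x $ S6)\<^sup>2 + 10 * (3 * x $ S6 - 2 * x $ S5)\<^sup>2 +
    30 * (2 * x $ S8 - x $ S5)\<^sup>2 + 2 * (x $ S5)\<^sup>2"
  by (simp add: e8_form_def power2_eq_square algebra_simps)

lemma e8_form_nonneg: "0 \<le> e8_form x"
proof -
  have "0 \<le> 120 * e8_form x"
    unfolding e8_form_squares by (intro add_nonneg_nonneg) simp_all
  then show ?thesis by simp
qed

text \<open>All squares in the decomposition vanish. Thus \<open>x $ S5\<close> is zero, and the
  zeros spread outward along the arms.\<close>

lemma e8_form_eq_0:
  assumes "e8_form x = 0"
  shows "x = 0"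
proof -
  note sq = e8_form_squares[of x, unfolded assms]
  note nn = zero_le_power2[of "2 * x $ S1 - x $ S2"] zero_le_power2[of "3 * x $ S2 - 2 * x $ S3"]
    zero_le_power2[of "4 * x $ S3 - 3 * x $ S4"] zero_le_power2[of "5 * x $ S4 - 4 * x $ S5"]
    zero_le_power2[of "2 * x $ S7 - x $ S6"] zero_le_power2[of "3 * x $ S6 - 2 * x $ S5"]
    zero_le_power2[of "2 * x $ S8 - x $ S5"] zero_le_power2[of "x $ S5"]
  have "(2 * x $ S1 - x $ S2)\<^sup>2 = 0" "(3 * x $ S2 - 2 * x $ S3)\<^sup>2 = 0"
    "(4 * x $ S3 - 3 * x $ S4)\<^sup>2 = 0" "(5 * x $ S4 - 4 * x $ S5)\<^sup>2 = 0"
    "(2 * x $ S7 - x $ S6)\<^sup>2 = 0" "(3 * x $ S6 - 2 * x $ S5)\<^sup>2 = 0"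
    "(2 * x $ S8 - x $ S5)\<^sup>2 = 0" "(x $ S5)\<^sup>2 = 0"
    using sq nn by linarith+
  then have "x $ S1 = 0" "x $ S2 = 0" "x $ S3 = 0" "x $ S4 = 0"
    "x $ S5 = 0" "x $ S6 = 0" "x $ S7 = 0" "x $ S8 = 0"
    by auto
  then have "x $ s = 0" for s by (cases s) auto
  then show ?thesis by (simp add: vec_eq_iff)
qed

text \<open>Two roots congruent modulo 2 agree up to sign: if \<open>y = x + 2 v\<close>, the parallelogram law gives
  \<open>e8_form v + e8_form (x + v) = 1\<close>, so one of the two terms vanishes.\<close>

lemma e8_roots_congruent:
  assumes x: "e8_form x = 1" and y: "e8_form y = 1" and even: "\<And>i. even (y $ i - x $ i)"
  shows "y = x \<or> y = - x"
proof -
  define v where "v = (\<chi> i. (y $ i - x $ i) div 2)"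
  have yv: "y $ i = x $ i + 2 * v $ i" for i
    using even[of i] by (simp add: v_def)
  have "e8_form y + e8_form x = 2 * (e8_form v + e8_form (x + v))"
    by (simp add: e8_form_def yv power2_eq_square algebra_simps)
  then have "e8_form v + e8_form (x + v) = 1" using x y by simp
  then have "e8_form v = 0 \<or> e8_form (x + v) = 0"
    using e8_form_nonneg[of v] e8_form_nonneg[of "x + v"] by linarith
  then show ?thesis
  proof
    assume "e8_form v = 0"
    then have "v = 0" by (rule e8_form_eq_0)
    then show ?thesis by (simp add: vec_eq_iff yv)
  next
    assume "e8_form (x + v) = 0"
    then have "x + v = 0" by (rule e8_form_eq_0)
    then have "x $ i + v $ i = 0" for i by (metis vector_add_component zero_index)
    then have "y $ i = - x $ i" for i using yv[of i] by (smt (verit))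
    then show ?thesis by (simp add: vec_eq_iff)
  qed
qed

text \<open>The sum of the simple roots is a root, so the signs of all simple roots agree.\<close>

lemma e8_root_matrix_mod2:
  assumes "e8.transpose_mod2 (e8.root_matrix w) = mat 1"
  shows "e8.root_matrix w = mat 1 \<or> e8.root_matrix w = - mat 1"
proof -
  let ?A = "e8.root_matrix w"
  have root: "?A *v x = x \<or> ?A *v x = - x" if "e8_form x = 1" for x
    using that by (intro e8_roots_congruent e8.transpose_mod2_eq_mat_1 assms)
      (simp_all add: e8_form_root_matrix)
  have "e8_form (axis s 1) = 1" for s
    by (cases s) (simp_all add: e8_form_def axis_def)
  then have off: "?A $ i $ j = 0" if "i \<noteq> j" for i j
    using root[of "axis j 1"] that by (auto simp: matrix_vector_axis[symmetric, of ?A] axis_def)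
  \<comment> \<open>With zero off-diagonal entries, each diagonal entry is a row sum, so the image
    of the all-ones vector displays all signs at once.\<close>
  have diag: "?A $ i $ i = (?A *v (\<chi> i. 1)) $ i" for i
  proof -
    have "(?A *v (\<chi> i. 1)) $ i = (\<Sum>j\<in>UNIV. ?A $ i $ j)"
      by (simp add: matrix_vector_mult_def)
    also have "\<dots> = (\<Sum>j\<in>UNIV. if i = j then ?A $ i $ i else 0)"
      by (intro sum.cong) (auto simp: off)
    finally show ?thesis by simp
  qed
  \<comment> \<open>The value is 8 vertices minus 7 edges.\<close>
  have "e8_form (\<chi> i. 1) = 1" by (simp add: e8_form_def)
  from root[OF this] show ?thesis
  proof
    assume "?A *v (\<chi> i. 1) = (\<chi> i. 1)"
    then have "?A = mat 1" by (auto simp: vec_eq_iff mat_def diag off)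
    then show ?thesis ..
  next
    assume "?A *v (\<chi> i. 1) = - (\<chi> i. 1)"
    then have "?A = - mat 1" by (auto simp: vec_eq_iff mat_def diag off)
    then show ?thesis ..
  qed
qed


section \<open>The central element\<close>

definition e8_coxeter_word :: "e8_vertex word" where
  "e8_coxeter_word = map (\<lambda>s. (s, True)) [S1, S2, S3, S4, S5, S6, S7, S8]"

text \<open>The Coxeter number of \<open>E\<^sub>8\<close> is 30, and \<open>-1\<close> is the 15th power of a Coxeter element.\<close>

definition e8_longest_word :: "e8_vertex word" where
  "e8_longest_word = concat (replicate 15 e8_coxeter_word)"

text \<open>Explicit coordinates let the reflections act as rewrite rules on eight
  arguments.\<close>

definition e8_vector :: "int \<Rightarrow> int \<Rightarrow> int \<Rightarrow> int \<Rightarrow> int \<Rightarrow> int \<Rightarrow> int \<Rightarrow> int \<Rightarrow> int ^ e8_vertex" where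
  "e8_vector a b c d e f g h = (\<chi> s. case s of S1 \<Rightarrow> a | S2 \<Rightarrow> b | S3 \<Rightarrow> c | S4 \<Rightarrow> d
    | S5 \<Rightarrow> e | S6 \<Rightarrow> f | S7 \<Rightarrow> g | S8 \<Rightarrow> h)"

lemma e8_reflection_vector:
  "e8.reflection S1 *v e8_vector a b c d e f g h = e8_vector (b - a) b c d e f g h"
  "e8.reflection S2 *v e8_vector a b c d e f g h = e8_vector a (a + c - b) c d e f g h"
  "e8.reflection S3 *v e8_vector a b c d e f g h = e8_vector a b (b + d - c) d e f g h"
  "e8.reflection S4 *v e8_vector a b c d e f g h = e8_vector a b c (c + e - d) e f g h"
  "e8.reflection S5 *v e8_vector a b c d e f g h = e8_vector a b c d (d + f + h - e) f g h"
  "e8.reflection S6 *v e8_vector a b c d e f g h = e8_vector a b c d e (e + g - f) g h"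
  "e8.reflection S7 *v e8_vector a b c d e f g h = e8_vector a b c d e f (f - g) h"
  "e8.reflection S8 *v e8_vector a b c d e f g h = e8_vector a b c d e f g (e - h)"
  by (simp_all add: vec_eq_iff e8.reflection_vector e8_neighbours e8_vector_def split: e8_vertex.split)

text \<open>The letters act from \<open>S8\<close> down to \<open>S1\<close>. With this symbolic
  evaluation the 15th power takes 15 rewrites per simple root.\<close>

lemma e8_coxeter_word_vector:
  "e8.root_matrix e8_coxeter_word *v e8_vector a b c d e f g h =
    e8_vector (e - g - h) (a + e - g - h) (b + e - g - h) (c + e - g - h) (d + e - g - h)
      (e - g) (f - g) (e - h)"
  by (simp add: e8_coxeter_word_def matrix_vector_mul_assoc[symmetric] e8_reflection_vector
      algebra_simps)

lemma e8_root_matrix_longest: "e8.root_matrix e8_longest_word = - mat 1"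
proof -
  let ?A = "e8.root_matrix e8_longest_word"
  have A: "?A *v x = ((*v) (e8.root_matrix e8_coxeter_word) ^^ 15) x" for x
    by (simp add: e8_longest_word_def numeral_eq_Suc e8.root_matrix_append
        matrix_vector_mul_assoc[symmetric])
  have ax: "axis s 1 = e8_vector (of_bool (s = S1)) (of_bool (s = S2)) (of_bool (s = S3))
      (of_bool (s = S4)) (of_bool (s = S5)) (of_bool (s = S6)) (of_bool (s = S7)) (of_bool (s = S8))" for s
    by (simp add: vec_eq_iff e8_vector_def axis_def split: e8_vertex.split)
  have minus: "- e8_vector a b c d e f g h =
      e8_vector (- a) (- b) (- c) (- d) (- e) (- f) (- g) (- h)" for a b c d e f g h
    by (simp add: vec_eq_iff e8_vector_def split: e8_vertex.split)
  have neg: "?A *v axis s 1 = - axis s 1" for s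
    unfolding A ax minus
    by (cases s) (simp_all add: numeral_eq_Suc e8_coxeter_word_vector)
  have "?A $ i $ j = (- axis j 1 :: int ^ e8_vertex) $ i" for i j
    by (simp only: matrix_vector_axis[symmetric] neg)
  then show ?thesis by (simp add: vec_eq_iff mat_def axis_def)
qed

section \<open>Kernel and center\<close>

theorem proposition7p11:
  fixes \<phi> :: "e8_vertex word set \<Rightarrow> bit ^ e8_vertex ^ e8_vertex"
  assumes "vogan_representation e8_graph \<phi>"
  shows "card (kernel (coxeter_group e8_graph) general_linear \<phi>) = 2 \<and>
    kernel (coxeter_group e8_graph) general_linear \<phi> = group_center (coxeter_group e8_graph)"
proof -
  let ?W = "coxeter_group e8_graph" and ?c = "word_class (coxeter_relators e8_graph)"
  let ?K = "kernel ?W general_linear \<phi>" and ?z = e8_longest_word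
  have carrier: "carrier ?W = range ?c"
    by (simp add: coxeter_group_def presented_group_carrier)
  have mult: "?c u \<otimes>\<^bsub>?W\<^esub> ?c v = ?c (u @ v)" for u v
    by (simp add: coxeter_group_def presented_group_mult)
  have class_eq: "?c u = ?c v \<longleftrightarrow> e8.root_matrix u = e8.root_matrix v" for u v
    by (simp add: word_class_eq_iff e8.root_matrix_faithful)
  have K: "?K = {?c w | w. \<phi> (?c w) = mat 1}"
    by (auto simp: kernel_def carrier general_linear_def)
  have neg: "- mat 1 ** A = - A" "A ** - mat 1 = - A" for A :: "int ^ e8_vertex ^ e8_vertex"
    by (simp_all add: matrix_matrix_mult_def mat_def vec_eq_iff if_distrib if_distribR
        sum_negf cong: if_cong)
  have one_neg: "mat 1 \<noteq> (- mat 1 :: int ^ e8_vertex ^ e8_vertex)"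
    by (auto simp: vec_eq_iff mat_def)
  have rev_z: "e8.root_matrix (rev ?z) = - mat 1"
    using e8.root_matrix_rev[of ?z] by (simp add: e8_root_matrix_longest neg minus_equation_iff)
  have "?K = {?c [], ?c ?z}"
  proof
    show "?K \<subseteq> {?c [], ?c ?z}"
    proof
      fix X assume "X \<in> ?K"
      then obtain w where w: "X = ?c w" "\<phi> (?c w) = mat 1" by (auto simp: K)
      \<comment> \<open>The representation reads the reversed word. The sign found for
        \<open>rev w\<close> passes to \<open>w\<close>, whose matrix is the inverse.\<close>
      then have "e8.root_matrix (rev w) = mat 1 \<or> e8.root_matrix (rev w) = - mat 1"
        using e8_root_matrix_mod2 by (simp add: e8.vogan_representation_word[OF assms])
      then have "e8.root_matrix w = mat 1 \<or> e8.root_matrix w = - mat 1"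
        using e8.root_matrix_rev[of w] by (auto simp: neg minus_equation_iff)
      then show "X \<in> {?c [], ?c ?z}"
        by (auto simp: w class_eq e8_root_matrix_longest)
    qed
    \<comment> \<open>Modulo 2 the signs 1 and -1 coincide, which puts the class of
      \<open>?z\<close> in the kernel.\<close>
    have "e8.transpose_mod2 (- mat 1) = mat 1"
      by (simp add: e8.transpose_mod2_def mat_def vec_eq_iff)
    then show "{?c [], ?c ?z} \<subseteq> ?K"
      by (auto simp: K e8.vogan_representation_word[OF assms] rev_z e8.transpose_mod2_mat_1)
  qed
  moreover have "?c [] \<noteq> ?c ?z"
    using one_neg by (simp add: class_eq e8_root_matrix_longest)
  \<comment> \<open>The matrices 1 and -1 commute with every matrix, and faithfulness carries this
    back to words.\<close>
  moreover have "{?c [], ?c ?z} \<subseteq> group_center ?W"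
    by (auto simp: group_center_def carrier mult class_eq e8.root_matrix_append
        e8_root_matrix_longest neg)
  moreover have "group_center ?W \<subseteq> ?K"
  proof
    fix X assume X: "X \<in> group_center ?W"
    then obtain w where w: "X = ?c w" by (auto simp: group_center_def carrier)
    have hom: "\<phi> (?c u \<otimes>\<^bsub>?W\<^esub> ?c v) = \<phi> (?c u) ** \<phi> (?c v)" for u v
      using assms hom_mult[of \<phi> ?W general_linear "?c u" "?c v"]
      by (simp add: vogan_representation_def carrier general_linear_def)
    have "\<phi> (?c w) = mat 1"
    proof (rule e8.commutes_with_vogan_matrices)
      show "invertible (\<phi> (?c w))"
        using assms hom_in_carrier[of \<phi> ?W general_linear "?c w"]
        by (simp add: vogan_representation_def carrier general_linear_def)
      show "\<phi> (?c w) ** vogan_matrix e8_graph s = vogan_matrix e8_graph s ** \<phi> (?c w)" for s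
      proof -
        have "?c w \<otimes>\<^bsub>?W\<^esub> ?c [(s, True)] = ?c [(s, True)] \<otimes>\<^bsub>?W\<^esub> ?c w"
          using X w by (auto simp: group_center_def carrier)
        then have "\<phi> (?c w) ** \<phi> (?c [(s, True)]) = \<phi> (?c [(s, True)]) ** \<phi> (?c w)"
          by (metis hom)
        moreover have "\<phi> (?c [(s, True)]) = vogan_matrix e8_graph s"
          using assms by (simp add: vogan_representation_def coxeter_generator_def)
        ultimately show ?thesis by simp
      qed
      have "{t. {t, s} \<in> e8_graph} \<noteq> {}" for s
        by (cases s) (simp_all add: e8_neighbours)
      then show "\<exists>t. {t, s} \<in> e8_graph" for s
        by simp
    qed
    then show "X \<in> ?K" by (auto simp: K w)
  qed
  \<comment> \<open>The center lies between \<open>{?c [], ?c ?z}\<close> and \<open>?K\<close>,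
    which are equal.\<close>
  ultimately show ?thesis by (auto simp: card_insert_if)
qed

end
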